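(* Let $\Delta x>0$, $\Delta t>0$, $\Gamma>0$, $\epsilon>0$, and let $\phi_i^k$ ($i$ the grid index, $k=0,1,2,\dots$ the time-step index) be generated on a uniform one-dimensional grid, from initial data $\phi_i^0$ and given velocities $u_i^k\in\mathbb{R}$, by the scheme $$\phi^{k+1}_i = \phi^k_i + \Delta t\left\{-\frac{u^k_{i+1}\phi^k_{i+1}-u^k_{i-1}\phi^k_{i-1}}{2\Delta x}+\phi_i^k\,\frac{u^k_{i+1}-u^k_{i-1}}{2\Delta x}\right\}+\Delta t\left[\Gamma\epsilon\,\frac{\phi^k_{i+1}-2\phi^k_i+\phi^k_{i-1}}{\Delta x^2}-\Gamma\,\frac{(1-\phi^k_{i+1})n^k_{i+1}\phi^k_{i+1}-(1-\phi^k_{i-1})n^k_{i-1}\phi^k_{i-1}}{2\Delta x}\right].$$ Suppose that $$\frac{\epsilon}{\Delta x}\ \ge\ \frac{\frac{|u|_{\max}}{\Gamma}+1}{2}$$ and that, for every $k\ge 0$, $$\Delta t\ \le\ \min_i\left[\frac{1}{\max\left\{\frac{2\Gamma\epsilon}{\Delta x^2}-\frac{u^k_{i+1}-u^k_{i-1}}{2\Delta x},\,0\right\}}\right].$$ If $0\le\phi_i^0\le 1$ for all $i$, then $0\le\phi_i^k\le 1$ for all $i$ and all $k\ge 0$.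
   Context: The scheme is the explicit-Euler, second-order central discretization of the one-dimensional form of $\partial_t\phi+\nabla\cdot(\vec u\phi)=\phi(\nabla\cdot\vec u)+\nabla\cdot[\Gamma\{\epsilon\nabla\phi-\phi(1-\phi)\vec n\}]$, where $\vec n=\nabla\phi/|\nabla\phi|$. The grid is finite and periodic: $i$ ranges over $\{1,\dots,N\}$ with $N\ge 3$ and indices are taken modulo $N$. The discrete normal is $n_i^k=\operatorname{sign}(\phi^k_{i+1}-\phi^k_{i-1})\in\{-1,0,1\}$ (with $\operatorname{sign}(0)=0$). $|u|_{\max}$ is the maximum velocity magnitude in the domain, so $|u_i^k|\le|u|_{\max}$ for all $i,k$. The convention $1/0=+\infty$ is used in the time-step condition. *)

theory Defs
  imports Complex_Main "HOL-Library.Extended_Real"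
begin

text \<open>
  Grid functions are maps \<open>nat \<Rightarrow> real\<close> of which only the values on the periodic grid
  \<open>{1..N}\<close> matter; a time-dependent grid function takes the time-step index first.
\<close>

definition right_nb :: "nat \<Rightarrow> nat \<Rightarrow> nat" where
  "right_nb N i = (if i = N then 1 else i + 1)"

definition left_nb :: "nat \<Rightarrow> nat \<Rightarrow> nat" where
  "left_nb N i = (if i = 1 then N else i - 1)"

definition discrete_normal :: "nat \<Rightarrow> (nat \<Rightarrow> real) \<Rightarrow> nat \<Rightarrow> real" where
  "discrete_normal N \<phi> i = sgn (\<phi> (right_nb N i) - \<phi> (left_nb N i))"

definition scheme_step ::
  "nat \<Rightarrow> real \<Rightarrow> real \<Rightarrow> real \<Rightarrow> real \<Rightarrow> (nat \<Rightarrow> real) \<Rightarrow> (nat \<Rightarrow> real) \<Rightarrow> nat \<Rightarrow> real" where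
  "scheme_step N \<Delta>x \<Delta>t \<Gamma> \<epsilon> u \<phi> i =
    (let r = right_nb N i; l = left_nb N i; n = discrete_normal N \<phi> in
      \<phi> i
      + \<Delta>t * (- ((u r * \<phi> r - u l * \<phi> l) / (2 * \<Delta>x)) + \<phi> i * ((u r - u l) / (2 * \<Delta>x)))
      + \<Delta>t * (\<Gamma> * \<epsilon> * ((\<phi> r - 2 * \<phi> i + \<phi> l) / \<Delta>x\<^sup>2)
              - \<Gamma> * (((1 - \<phi> r) * n r * \<phi> r - (1 - \<phi> l) * n l * \<phi> l) / (2 * \<Delta>x))))"

definition speeds :: "nat \<Rightarrow> (nat \<Rightarrow> nat \<Rightarrow> real) \<Rightarrow> real set" where
  "speeds N u = {\<bar>u k i\<bar> | k i. i \<in> {1..N}}"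

text \<open>
  There are infinitely many time steps, so the maximum is taken as a supremum; it is meaningful
  only if \<open>speeds N u\<close> is bounded above.
\<close>

definition max_speed :: "nat \<Rightarrow> (nat \<Rightarrow> nat \<Rightarrow> real) \<Rightarrow> real" where
  "max_speed N u = Sup (speeds N u)"

text \<open>
  The bound on the time step is an extended real because its denominator may vanish, in which
  case the quotient is \<open>\<infinity>\<close> (on \<^typ>\<open>real\<close> it would be \<open>0\<close>).
\<close>

definition time_step_bound ::
  "nat \<Rightarrow> real \<Rightarrow> real \<Rightarrow> real \<Rightarrow> (nat \<Rightarrow> real) \<Rightarrow> ereal" where
  "time_step_bound N \<Delta>x \<Gamma> \<epsilon> u =
    (MIN i\<in>{1..N}.
      1 / ereal (max (2 * \<Gamma> * \<epsilon> / \<Delta>x\<^sup>2 - (u (right_nb N i) - u (left_nb N i)) / (2 * \<Delta>x)) 0))"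

lemma one_divide_ereal_zero: "1 / ereal 0 = \<infinity>"
  by (simp add: divide_ereal_def)

end

theory Submission
  imports Defs
begin

text \<open>
  The new value at a grid point is a combination of the old values at the point and its two
  neighbours, with coefficients that still depend on the old values through the sharpening flux.
  The mesh condition makes the neighbour coefficients nonnegative and the time-step condition makes
  the central one nonnegative, so nonnegativity is preserved. Constants are preserved by the
  advective part, and \<open>1 - \<phi>\<close> obeys the same scheme with the normal reversed; applying the same
  argument to \<open>1 - \<phi>\<close> gives the upper bound.
\<close>

lemma right_nb_in_grid: "i \<in> {1..N} \<Longrightarrow> right_nb N i \<in> {1..N}"
  by (auto simp: right_nb_def)

lemma left_nb_in_grid: "i \<in> {1..N} \<Longrightarrow> left_nb N i \<in> {1..N}"
  by (auto simp: left_nb_def)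

lemma abs_discrete_normal_le_1: "\<bar>discrete_normal N \<phi> i\<bar> \<le> 1"
  by (simp add: discrete_normal_def sgn_if)

lemma abs_le_max_speed:
  assumes "bdd_above (speeds N u)" "i \<in> {1..N}"
  shows "\<bar>u k i\<bar> \<le> max_speed N u"
  unfolding max_speed_def using assms by (intro cSup_upper) (auto simp: speeds_def)

lemma le_one_divide_ereal_max_zeroD:
  assumes "ereal t \<le> 1 / ereal (max m 0)" "0 \<le> t"
  shows "t * m \<le> 1"
proof (cases "m > 0")
  case True
  then have "t \<le> 1 / m"
    using assms(1) by (simp add: max_def one_ereal_def)
  with True show ?thesis
    by (simp add: pos_le_divide_eq)
next
  \<comment> \<open>Here the bound is \<open>1 / 0\<close>, that is infinity, and carries no
    information; the sign of \<open>m\<close> is enough.\<close>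
  case False
  with assms(2) have "t * m \<le> 0"
    by (simp add: mult_nonneg_nonpos)
  then show ?thesis by simp
qed

lemma time_step_boundD:
  assumes "ereal \<Delta>t \<le> time_step_bound N \<Delta>x \<Gamma> \<epsilon> u" "0 \<le> \<Delta>t" "i \<in> {1..N}"
  shows "\<Delta>t * (2 * \<Gamma> * \<epsilon> / \<Delta>x\<^sup>2 - (u (right_nb N i) - u (left_nb N i)) / (2 * \<Delta>x)) \<le> 1"
proof (rule le_one_divide_ereal_max_zeroD)
  have "time_step_bound N \<Delta>x \<Gamma> \<epsilon> u \<le> 1 / ereal (max
      (2 * \<Gamma> * \<epsilon> / \<Delta>x\<^sup>2 - (u (right_nb N i) - u (left_nb N i)) / (2 * \<Delta>x)) 0)"
    unfolding time_step_bound_def using assms(3) by (intro Min_le) auto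
  with assms(1) show "ereal \<Delta>t \<le> 1 / ereal (max
      (2 * \<Gamma> * \<epsilon> / \<Delta>x\<^sup>2 - (u (right_nb N i) - u (left_nb N i)) / (2 * \<Delta>x)) 0)"
    by (rule order_trans)
qed fact

text \<open>Scaling the hypothesis by \<open>\<Gamma> / \<Delta>x\<close> turns it into a comparison
  of the diffusion coefficient with the largest possible transport coefficient, velocity plus
  sharpening, of a neighbour.\<close>

lemma mesh_conditionD:
  fixes \<Delta>x \<Gamma> \<epsilon> U :: real
  assumes "\<epsilon> / \<Delta>x \<ge> (U / \<Gamma> + 1) / 2" "\<Delta>x > 0" "\<Gamma> > 0"
  shows "(U + \<Gamma>) / (2 * \<Delta>x) \<le> \<Gamma> * \<epsilon> / \<Delta>x\<^sup>2"
proof -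
  have "(U + \<Gamma>) / (2 * \<Delta>x) = (\<Gamma> / \<Delta>x) * ((U / \<Gamma> + 1) / 2)"
    using assms(2,3) by (simp add: field_simps)
  also have "\<dots> \<le> (\<Gamma> / \<Delta>x) * (\<epsilon> / \<Delta>x)"
    using assms by (intro mult_left_mono) auto
  finally show ?thesis
    by (simp add: power2_eq_square)
qed

text \<open>The factor \<open>s\<close> stands for \<open>1 - \<phi>\<close> or for
  \<open>\<phi>\<close> at a neighbour, and \<open>n\<close> for the normal or its negative, so that
  both bounds on the scheme are served.\<close>

lemma abs_flux_coefficient_le:
  fixes v s n U G :: real
  assumes "\<bar>v\<bar> \<le> U" "0 \<le> s" "s \<le> 1" "\<bar>n\<bar> \<le> 1" "0 \<le> G"
  shows "\<bar>v + G * (s * n)\<bar> \<le> U + G"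
proof -
  have "\<bar>s * n\<bar> \<le> 1"
    using mult_mono[of "\<bar>s\<bar>" 1 "\<bar>n\<bar>" 1] assms by (simp add: abs_mult)
  then have "\<bar>G * (s * n)\<bar> \<le> G"
    using mult_left_mono[of "\<bar>s * n\<bar>" 1 G] assms(5) by (simp add: abs_mult)
  with assms(1) show ?thesis by linarith
qed

text \<open>Here \<open>c\<close>, \<open>a\<close>, \<open>b\<close> are the values at the centre
  and at the right and left neighbours, \<open>D\<close> is the diffusion coefficient and
  \<open>h\<close> is \<open>2 * \<Delta>x\<close>. Each summand is nonnegative by itself, since
  \<open>\<bar>p\<bar> / h\<close> and \<open>\<bar>q\<bar> / h\<close> are at most
  \<open>S / h \<le> D\<close>.\<close>

lemma three_point_combination_nonneg:
  fixes a b c D h t p q m S :: real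
  assumes "0 \<le> a" "0 \<le> b" "0 \<le> c" "0 \<le> t" "0 < h"
    and "\<bar>p\<bar> \<le> S" "\<bar>q\<bar> \<le> S" "S / h \<le> D" "t * m \<le> 1"
  shows "0 \<le> c * (1 - t * m) + t * (a * (D - p / h)) + t * (b * (D + q / h))"
proof -
  have "p / h \<le> S / h" "- q / h \<le> S / h"
    using assms by (intro divide_right_mono; linarith)+
  then have "0 \<le> D - p / h" "0 \<le> D + q / h"
    using assms(8) by auto
  then have "0 \<le> c * (1 - t * m)" "0 \<le> t * (a * (D - p / h))" "0 \<le> t * (b * (D + q / h))"
    using assms by simp_all
  then show ?thesis by linarith
qed

text \<open>From each sharpening flux \<open>\<phi>\<close> is pulled out and
  \<open>1 - \<phi>\<close> stays in the coefficient. Diffusion and the \<open>\<phi> i\<close>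
  times divergence term together yield, at the centre, exactly the quantity in the time-step
  bound.\<close>

lemma scheme_step_eq:
  fixes N i
  defines "r \<equiv> right_nb N i" and "l \<equiv> left_nb N i"
  shows "scheme_step N \<Delta>x \<Delta>t \<Gamma> \<epsilon> u \<phi> i =
      \<phi> i * (1 - \<Delta>t * (2 * \<Gamma> * \<epsilon> / \<Delta>x\<^sup>2 - (u r - u l) / (2 * \<Delta>x)))
    + \<Delta>t * (\<phi> r * (\<Gamma> * \<epsilon> / \<Delta>x\<^sup>2
        - (u r + \<Gamma> * ((1 - \<phi> r) * discrete_normal N \<phi> r)) / (2 * \<Delta>x)))
    + \<Delta>t * (\<phi> l * (\<Gamma> * \<epsilon> / \<Delta>x\<^sup>2
        + (u l + \<Gamma> * ((1 - \<phi> l) * discrete_normal N \<phi> l)) / (2 * \<Delta>x)))"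
  unfolding scheme_step_def Let_def r_def l_def divide_inverse by algebra

text \<open>The product \<open>\<phi> * (1 - \<phi>)\<close> is symmetric, so now
  \<open>1 - \<phi>\<close> is pulled out and \<open>\<phi>\<close> stays; subtraction from 1 flips
  the sign of the flux, which the negated normal absorbs.\<close>

lemma one_minus_scheme_step_eq:
  fixes N i
  defines "r \<equiv> right_nb N i" and "l \<equiv> left_nb N i"
  shows "1 - scheme_step N \<Delta>x \<Delta>t \<Gamma> \<epsilon> u \<phi> i =
      (1 - \<phi> i) * (1 - \<Delta>t * (2 * \<Gamma> * \<epsilon> / \<Delta>x\<^sup>2 - (u r - u l) / (2 * \<Delta>x)))
    + \<Delta>t * ((1 - \<phi> r) * (\<Gamma> * \<epsilon> / \<Delta>x\<^sup>2
        - (u r + \<Gamma> * (\<phi> r * - discrete_normal N \<phi> r)) / (2 * \<Delta>x)))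
    + \<Delta>t * ((1 - \<phi> l) * (\<Gamma> * \<epsilon> / \<Delta>x\<^sup>2
        + (u l + \<Gamma> * (\<phi> l * - discrete_normal N \<phi> l)) / (2 * \<Delta>x)))"
proof -
  \<comment> \<open>With the inverses as atoms the identity is polynomial; no cancellation of
    \<open>\<Delta>x\<close> is involved.\<close>
  define h where "h = inverse (2 * \<Delta>x)"
  show ?thesis
    unfolding scheme_step_def Let_def r_def l_def divide_inverse h_def[symmetric] by algebra
qed

lemma scheme_step_bounds:
  assumes "\<Delta>x > 0" "\<Delta>t \<ge> 0" "\<Gamma> > 0" "i \<in> {1..N}"
    and speed: "\<And>j. j \<in> {1..N} \<Longrightarrow> \<bar>u j\<bar> \<le> U"
    and mesh: "\<epsilon> / \<Delta>x \<ge> (U / \<Gamma> + 1) / 2"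
    and step: "ereal \<Delta>t \<le> time_step_bound N \<Delta>x \<Gamma> \<epsilon> u"
    and bounds: "\<And>j. j \<in> {1..N} \<Longrightarrow> 0 \<le> \<phi> j \<and> \<phi> j \<le> 1"
  shows "0 \<le> scheme_step N \<Delta>x \<Delta>t \<Gamma> \<epsilon> u \<phi> i \<and> scheme_step N \<Delta>x \<Delta>t \<Gamma> \<epsilon> u \<phi> i \<le> 1"
proof
  note r = right_nb_in_grid[OF \<open>i \<in> {1..N}\<close>]
  note l = left_nb_in_grid[OF \<open>i \<in> {1..N}\<close>]
  note facts = assms(1-4) r l bounds[OF r] bounds[OF l] bounds[OF \<open>i \<in> {1..N}\<close>]
    speed[OF r] speed[OF l] abs_discrete_normal_le_1
    mesh_conditionD[OF mesh assms(1,3)] time_step_boundD[OF step assms(2,4)]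
  show "0 \<le> scheme_step N \<Delta>x \<Delta>t \<Gamma> \<epsilon> u \<phi> i"
    unfolding scheme_step_eq using facts
    by (intro three_point_combination_nonneg[where S = "U + \<Gamma>"] abs_flux_coefficient_le) auto
  have "0 \<le> 1 - scheme_step N \<Delta>x \<Delta>t \<Gamma> \<epsilon> u \<phi> i"
    unfolding one_minus_scheme_step_eq using facts
    by (intro three_point_combination_nonneg[where S = "U + \<Gamma>"] abs_flux_coefficient_le) auto
  then show "scheme_step N \<Delta>x \<Delta>t \<Gamma> \<epsilon> u \<phi> i \<le> 1"
    by simp
qed

theorem theorem3p1:
  fixes N :: nat
    and \<Delta>x \<Delta>t \<Gamma> \<epsilon> :: real
    and u \<phi> :: "nat \<Rightarrow> nat \<Rightarrow> real"
  assumes "N \<ge> 3"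
    and "\<Delta>x > 0" and "\<Delta>t > 0" and "\<Gamma> > 0" and "\<epsilon> > 0"
    and "\<And>k i. i \<in> {1..N} \<Longrightarrow> \<phi> (Suc k) i = scheme_step N \<Delta>x \<Delta>t \<Gamma> \<epsilon> (u k) (\<phi> k) i"
    and "bdd_above (speeds N u)"
    and "\<epsilon> / \<Delta>x \<ge> (max_speed N u / \<Gamma> + 1) / 2"
    and "\<And>k. ereal \<Delta>t \<le> time_step_bound N \<Delta>x \<Gamma> \<epsilon> (u k)"
    and "\<And>i. i \<in> {1..N} \<Longrightarrow> 0 \<le> \<phi> 0 i \<and> \<phi> 0 i \<le> 1"
  shows "\<forall>k. \<forall>i\<in>{1..N}. 0 \<le> \<phi> k i \<and> \<phi> k i \<le> 1"
proof
  fix k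
  show "\<forall>i\<in>{1..N}. 0 \<le> \<phi> k i \<and> \<phi> k i \<le> 1"
  proof (induction k)
    case 0
    show ?case using assms(10) by blast
  next
    case (Suc k)
    have "0 \<le> scheme_step N \<Delta>x \<Delta>t \<Gamma> \<epsilon> (u k) (\<phi> k) i \<and> scheme_step N \<Delta>x \<Delta>t \<Gamma> \<epsilon> (u k) (\<phi> k) i \<le> 1"
      if "i \<in> {1..N}" for i
      \<comment> \<open>\<open>max_speed\<close> is a supremum over all time steps, so a single
        \<open>U\<close> serves every \<open>k\<close>.\<close>
      using Suc.IH assms(2-4,7-9) that
      by (intro scheme_step_bounds[where U = "max_speed N u"] abs_le_max_speed) auto
    then show ?case
      using assms(6) by simp
  qed
qed

end
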